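(* Let $T:V\to\mathfrak g$ be an embedding tensor on a $3$-Lie algebra $(\mathfrak g,[\cdot,\cdot,\cdot]_{\mathfrak g})$ with respect to a representation $(V;\rho)$. Define a linear map $[\cdot,\cdot,\cdot]_T:\otimes^3V\to V$ by $$[u,v,w]_T=\rho(Tu,Tv)w,\qquad \forall u,v,w\in V.$$ Then $(V,[\cdot,\cdot,\cdot]_T)$ is a $3$-Leibniz algebra. Moreover, $T$ is a homomorphism from the $3$-Leibniz algebra $(V,[\cdot,\cdot,\cdot]_T)$ to the $3$-Lie algebra $(\mathfrak g,[\cdot,\cdot,\cdot]_{\mathfrak g})$, that is, $T$ is linear and $T[u,v,w]_T=[Tu,Tv,Tw]_{\mathfrak g}$ for all $u,v,w\in V$.
   Context: All vector spaces are over an algebraically closed field $\mathbb K$ of characteristic $0$. A $3$-Lie algebra is a vector space $\mathfrak g$ with a skew-symmetric trilinear bracket $[\cdot,\cdot,\cdot]_{\mathfrak g}$ such that $[x_1,x_2,[x_3,x_4,x_5]_{\mathfrak g}]_{\mathfrak g}=[[x_1,x_2,x_3]_{\mathfrak g},x_4,x_5]_{\mathfrak g}+[x_3,[x_1,x_2,x_4]_{\mathfrak g},x_5]_{\mathfrak g}+[x_3,x_4,[x_1,x_2,x_5]_{\mathfrak g}]_{\mathfrak g}$ for all $x_i\in\mathfrak g$. A representation of $\mathfrak g$ on a vector space $V$ is a linear map $\rho:\wedge^2\mathfrak g\to\mathfrak{gl}(V)$ such that for all $x_i\in\mathfrak g$: $\rho(x_1,x_2)\rho(x_3,x_4)=\rho([x_1,x_2,x_3]_{\mathfrak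 g},x_4)+\rho(x_3,[x_1,x_2,x_4]_{\mathfrak g})+\rho(x_3,x_4)\rho(x_1,x_2)$ and $\rho(x_1,[x_2,x_3,x_4]_{\mathfrak g})=\rho(x_3,x_4)\rho(x_1,x_2)-\rho(x_2,x_4)\rho(x_1,x_3)+\rho(x_2,x_3)\rho(x_1,x_4)$. An embedding tensor on $\mathfrak g$ with respect to $(V;\rho)$ is a linear map $T:V\to\mathfrak g$ with $[Tu,Tv,Tw]_{\mathfrak g}=T(\rho(Tu,Tv)w)$ for all $u,v,w\in V$. A $3$-Leibniz algebra is a vector space $\mathcal L$ with a trilinear bracket satisfying $[x_1,x_2,[y_1,y_2,y_3]]=[[x_1,x_2,y_1],y_2,y_3]+[y_1,[x_1,x_2,y_2],y_3]+[y_1,y_2,[x_1,x_2,y_3]]$ for all elements. *)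

theory Defs
  imports "HOL-Computational_Algebra.Polynomial"
begin

locale trilinear_bracket = vector_space scale
  for scale :: "'k::{alg_closed_field, field_char_0} \<Rightarrow> 'g::ab_group_add \<Rightarrow> 'g" +
  fixes bracket :: "'g \<Rightarrow> 'g \<Rightarrow> 'g \<Rightarrow> 'g"
  assumes linear_bracket_1: "Vector_Spaces.linear scale scale (\<lambda>x. bracket x y z)"
    and linear_bracket_2: "Vector_Spaces.linear scale scale (\<lambda>y. bracket x y z)"
    and linear_bracket_3: "Vector_Spaces.linear scale scale (\<lambda>z. bracket x y z)"

locale three_leibniz_algebra = trilinear_bracket scale bracket
  for scale :: "'k::{alg_closed_field, field_char_0} \<Rightarrow> 'g::ab_group_add \<Rightarrow> 'g"
    and bracket :: "'g \<Rightarrow> 'g \<Rightarrow> 'g \<Rightarrow> 'g" +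
  assumes leibniz_identity:
    "bracket x1 x2 (bracket y1 y2 y3) =
       bracket (bracket x1 x2 y1) y2 y3
     + bracket y1 (bracket x1 x2 y2) y3
     + bracket y1 y2 (bracket x1 x2 y3)"

text \<open>The two adjacent transpositions generate the symmetric group on the three arguments,
  so the two sign rules below are full skew-symmetry.\<close>

locale three_lie_algebra = trilinear_bracket scale bracket
  for scale :: "'k::{alg_closed_field, field_char_0} \<Rightarrow> 'g::ab_group_add \<Rightarrow> 'g"
    and bracket :: "'g \<Rightarrow> 'g \<Rightarrow> 'g \<Rightarrow> 'g" +
  assumes skew_12: "bracket y x z = - bracket x y z"
    and skew_23: "bracket x z y = - bracket x y z"
    and fundamental_identity:
    "bracket x1 x2 (bracket x3 x4 x5) =
       bracket (bracket x1 x2 x3) x4 x5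
     + bracket x3 (bracket x1 x2 x4) x5
     + bracket x3 x4 (bracket x1 x2 x5)"

sublocale three_lie_algebra \<subseteq> three_leibniz_algebra
  by unfold_locales (rule fundamental_identity)

text \<open>A linear map from the second exterior power of the algebra to the endomorphisms of the
  module is given, through the universal property, by an alternating bilinear map; its values
  are the operators \<open>rho x y\<close>. The operator identities are stated pointwise.\<close>

locale three_lie_representation =
  three_lie_algebra scaleG bracket + V: vector_space scaleV
  for scaleG :: "'k::{alg_closed_field, field_char_0} \<Rightarrow> 'g::ab_group_add \<Rightarrow> 'g"
    and bracket :: "'g \<Rightarrow> 'g \<Rightarrow> 'g \<Rightarrow> 'g"
    and scaleV :: "'k \<Rightarrow> 'v::ab_group_add \<Rightarrow> 'v" +
  fixes rho :: "'g \<Rightarrow> 'g \<Rightarrow> 'v \<Rightarrow> 'v"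
  assumes rho_endomorphism: "Vector_Spaces.linear scaleV scaleV (rho x y)"
    and rho_linear_1: "Vector_Spaces.linear scaleG scaleV (\<lambda>x. rho x y v)"
    and rho_linear_2: "Vector_Spaces.linear scaleG scaleV (\<lambda>y. rho x y v)"
    and rho_alternating: "rho x x v = 0"
    and rho_comm:
    "rho x1 x2 (rho x3 x4 v) =
       rho (bracket x1 x2 x3) x4 v + rho x3 (bracket x1 x2 x4) v + rho x3 x4 (rho x1 x2 v)"
    and rho_bracket:
    "rho x1 (bracket x2 x3 x4) v =
       rho x3 x4 (rho x1 x2 v) - rho x2 x4 (rho x1 x3 v) + rho x2 x3 (rho x1 x4 v)"

locale embedding_tensor =
  three_lie_representation scaleG bracket scaleV rho + T: Vector_Spaces.linear scaleV scaleG T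
  for scaleG :: "'k::{alg_closed_field, field_char_0} \<Rightarrow> 'g::ab_group_add \<Rightarrow> 'g"
    and bracket :: "'g \<Rightarrow> 'g \<Rightarrow> 'g \<Rightarrow> 'g"
    and scaleV :: "'k \<Rightarrow> 'v::ab_group_add \<Rightarrow> 'v"
    and rho :: "'g \<Rightarrow> 'g \<Rightarrow> 'v \<Rightarrow> 'v"
    and T :: "'v \<Rightarrow> 'g" +
  assumes embedding: "bracket (T u) (T v) (T w) = T (rho (T u) (T v) w)"

definition induced_bracket ::
  "('g \<Rightarrow> 'g \<Rightarrow> 'v \<Rightarrow> 'v) \<Rightarrow> ('v \<Rightarrow> 'g) \<Rightarrow> 'v \<Rightarrow> 'v \<Rightarrow> 'v \<Rightarrow> 'v" where
  "induced_bracket rho T u v w = rho (T u) (T v) w"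

text \<open>The target may be a 3-Lie algebra, which is a 3-Leibniz algebra by the sublocale
  relation above.\<close>

locale three_leibniz_homomorphism =
  source: three_leibniz_algebra scaleA bracketA +
  target: three_leibniz_algebra scaleB bracketB +
  Vector_Spaces.linear scaleA scaleB f
  for scaleA :: "'k::{alg_closed_field, field_char_0} \<Rightarrow> 'a::ab_group_add \<Rightarrow> 'a"
    and bracketA :: "'a \<Rightarrow> 'a \<Rightarrow> 'a \<Rightarrow> 'a"
    and scaleB :: "'k \<Rightarrow> 'b::ab_group_add \<Rightarrow> 'b"
    and bracketB :: "'b \<Rightarrow> 'b \<Rightarrow> 'b \<Rightarrow> 'b"
    and f :: "'a \<Rightarrow> 'b" +
  assumes hom_bracket: "f (bracketA u v w) = bracketB (f u) (f v) (f w)"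

end

theory Submission
  imports Defs
begin

text \<open>Regard an identity between the operators \<open>rho x y\<close> and pull it back along \<open>T\<close>. The
  commutation rule of a representation says that \<open>rho x1 x2\<close> commutes past \<open>rho x3 x4\<close> up to
  letting the derivation \<open>bracket x1 x2\<close> act on \<open>x3\<close> and \<open>x4\<close>. When all four arguments
  lie in the image of \<open>T\<close>, the embedding tensor equation turns that derivation into the image
  under \<open>T\<close> of an induced bracket, and the rule becomes the Leibniz identity. The same equation
  is also exactly the statement that \<open>T\<close> intertwines the two brackets. The induced bracket is
  in general not skew-symmetric, because its third argument is treated differently from the
  first two.\<close>

context embedding_tensor
begin

lemma T_induced_bracket:
  "T (induced_bracket rho T u v w) = bracket (T u) (T v) (T w)"
  by (simp add: induced_bracket_def embedding)

lemma induced_bracket_trilinear: "trilinear_bracket scaleV (induced_bracket rho T)"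
proof (intro trilinear_bracket.intro trilinear_bracket_axioms.intro V.vector_space_axioms)
  fix u v w
  have T_linear: "Vector_Spaces.linear scaleV scaleG T"
    by (rule T.linear_axioms)
  show "Vector_Spaces.linear scaleV scaleV (\<lambda>u. induced_bracket rho T u v w)"
    using Vector_Spaces.linear_compose[OF T_linear rho_linear_1] by (simp add: induced_bracket_def o_def)
  show "Vector_Spaces.linear scaleV scaleV (\<lambda>v. induced_bracket rho T u v w)"
    using Vector_Spaces.linear_compose[OF T_linear rho_linear_2] by (simp add: induced_bracket_def o_def)
  show "Vector_Spaces.linear scaleV scaleV (\<lambda>w. induced_bracket rho T u v w)"
    by (simp add: induced_bracket_def rho_endomorphism)
qed

text \<open>This is \<open>rho_comm\<close> restricted to the image of \<open>T\<close>: the embedding tensor equation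
  rewrites each \<open>bracket (T u) (T v) (T x)\<close> in it as \<open>T (rho (T u) (T v) x)\<close>.\<close>

lemma induced_bracket_three_leibniz: "three_leibniz_algebra scaleV (induced_bracket rho T)"
proof (intro three_leibniz_algebra.intro three_leibniz_algebra_axioms.intro)
  show "trilinear_bracket scaleV (induced_bracket rho T)"
    by (rule induced_bracket_trilinear)
next
  fix u v x y w
  show "induced_bracket rho T u v (induced_bracket rho T x y w) =
      induced_bracket rho T (induced_bracket rho T u v x) y w
    + induced_bracket rho T x (induced_bracket rho T u v y) w
    + induced_bracket rho T x y (induced_bracket rho T u v w)"
    using rho_comm[of "T u" "T v" "T x" "T y" w] by (simp add: induced_bracket_def embedding)
qed

lemma three_leibniz_homomorphism_T:
  "three_leibniz_homomorphism scaleV (induced_bracket rho T) scaleG bracket T"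
  by (intro three_leibniz_homomorphism.intro three_leibniz_homomorphism_axioms.intro
      induced_bracket_three_leibniz three_leibniz_algebra_axioms T.linear_axioms
      T_induced_bracket)

end

theorem proposition2p7:
  fixes scaleG :: "'k::{alg_closed_field, field_char_0} \<Rightarrow> 'g::ab_group_add \<Rightarrow> 'g"
    and bracket :: "'g \<Rightarrow> 'g \<Rightarrow> 'g \<Rightarrow> 'g"
    and scaleV :: "'k \<Rightarrow> 'v::ab_group_add \<Rightarrow> 'v"
    and rho :: "'g \<Rightarrow> 'g \<Rightarrow> 'v \<Rightarrow> 'v"
    and T :: "'v \<Rightarrow> 'g"
  assumes "three_lie_algebra scaleG bracket"
    and "three_lie_representation scaleG bracket scaleV rho"
    and "embedding_tensor scaleG bracket scaleV rho T"
  shows "three_leibniz_algebra scaleV (induced_bracket rho T) \<and>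
    three_leibniz_homomorphism scaleV (induced_bracket rho T) scaleG bracket T"
  using embedding_tensor.induced_bracket_three_leibniz[OF assms(3)]
    embedding_tensor.three_leibniz_homomorphism_T[OF assms(3)]
  by (rule conjI)

end
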